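(* For every finite ground set $E$, every downward-closed family $\mathcal{F}\subseteq 2^E$, and every product distribution $D$ of the element weights, $$\textsf{RoE}(\mathcal{F},D)\ge \frac{\textsf{EoR}(\mathcal{F},D)}{68}.$$
   Context: Setting (prophet inequality under a downward-closed constraint). $E$ is a finite ground set and $\mathcal{F}\subseteq 2^E$ is downward-closed (if $S\in\mathcal{F}$ and $T\subseteq S$ then $T\in\mathcal{F}$). Each $e\in E$ has a nonnegative random weight $w_e\sim D_e$, independently across elements; the distributions $D_e$ have no point masses, and $D=\times_{e\in E}D_e$ is the product distribution. The elements arrive one by one in a fixed order, each revealed together with its realized weight; an online algorithm (which knows $\mathcal{F}$ and $D$ and may be randomized) must decide immediately and irrevocably upon each arrival whether to accept the element, keeping the accepted set in $\mathcal{F}$ at all times. Let $f(\boldsymbol{w})=\max_{S\in\mathcal{F}}\sum_{e\in S}w_e$ be the offline optimum, and let $\textsf{ALG}(\boldsymbol{w})$ be the set chosen by algorithm $\textsf{ALG}$, with value $\boldsymbol{w}(\textsf{ALG}(\boldsymbol{w}))=\sum_{e\in\textsf{ALG}(\boldsymbol{w})}w_e$. Define $\textsf{EoR}(\mathcal{F},D,\textsf{ALG})=\mathbf{E}[\boldsymbol{w}(\textsf{ALG}(\boldsymbol{w}))/f(\boldsymbol{w})]$ and $\textsf{RoE}(\mathcal{F},D,\textsf{ALG})=\mathbf{E}[\boldsymbol{w}(\textsf{ALG}(\boldsymbol{w}))]/\mathbf{E}[f(\boldsymbol{w})]$ (expectations over $\boldsymbol{w}\sim D$ and the algorithm's randomness);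 $\textsf{EoR}(\mathcal{F},D)=\sup_{\textsf{ALG}}\textsf{EoR}(\mathcal{F},D,\textsf{ALG})$ and $\textsf{RoE}(\mathcal{F},D)=\sup_{\textsf{ALG}}\textsf{RoE}(\mathcal{F},D,\textsf{ALG})$. *)

theory Defs
  imports "HOL-Probability.Probability"
begin

text \<open>Ground set E = {0..<n}; elements arrive in the order 0, 1, ..., n-1.\<close>

definition downward_closed :: "nat set set \<Rightarrow> bool" where
  "downward_closed F \<longleftrightarrow> (\<forall>S\<in>F. \<forall>T. T \<subseteq> S \<longrightarrow> T \<in> F)"

definition offline_opt :: "nat set set \<Rightarrow> (nat \<Rightarrow> real) \<Rightarrow> real" where
  "offline_opt F w = Max ((\<lambda>S. \<Sum>e\<in>S. w e) ` F)"

text \<open>Source of the algorithm's internal randomness: a uniform seed in [0,1],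
  independent of the weights.\<close>
definition seed_space :: "real measure" where
  "seed_space = uniform_measure lborel {0..1}"

text \<open>Randomized online algorithms: given the seed u and the weight vector w,
  A u w is the set of accepted elements. Whether element i is accepted depends
  only on u and w 0, ..., w i (decision made upon arrival, irrevocably); the
  accepted set is always feasible (by downward closure, so are all prefixes of it);
  acceptance events are measurable.\<close>
definition online_algs :: "nat \<Rightarrow> nat set set \<Rightarrow> (real \<Rightarrow> (nat \<Rightarrow> real) \<Rightarrow> nat set) set" where
  "online_algs n F = {A.
     (\<forall>u w. A u w \<in> F) \<and>
     (\<forall>u w w' i. i < n \<longrightarrow> (\<forall>j\<le>i. w j = w' j) \<longrightarrow> (i \<in> A u w \<longleftrightarrow> i \<in> A u w')) \<and>
     (\<forall>i<n. (\<lambda>(u, w). indicator (A u w) i :: real)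
              \<in> borel_measurable (borel \<Otimes>\<^sub>M PiM {0..<n} (\<lambda>_. borel)))}"

definition alg_value :: "(real \<Rightarrow> (nat \<Rightarrow> real) \<Rightarrow> nat set) \<Rightarrow> real \<Rightarrow> (nat \<Rightarrow> real) \<Rightarrow> real" where
  "alg_value A u w = (\<Sum>e\<in>A u w. w e)"

definition EoR_alg :: "nat \<Rightarrow> nat set set \<Rightarrow> (nat \<Rightarrow> real measure)
    \<Rightarrow> (real \<Rightarrow> (nat \<Rightarrow> real) \<Rightarrow> nat set) \<Rightarrow> real" where
  "EoR_alg n F D A =
     (\<integral>(u, w). alg_value A u w / offline_opt F w \<partial>(seed_space \<Otimes>\<^sub>M PiM {0..<n} D))"

definition RoE_alg :: "nat \<Rightarrow> nat set set \<Rightarrow> (nat \<Rightarrow> real measure)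
    \<Rightarrow> (real \<Rightarrow> (nat \<Rightarrow> real) \<Rightarrow> nat set) \<Rightarrow> real" where
  "RoE_alg n F D A =
     (\<integral>(u, w). alg_value A u w \<partial>(seed_space \<Otimes>\<^sub>M PiM {0..<n} D))
     / (\<integral>w. offline_opt F w \<partial>(PiM {0..<n} D))"

definition EoR :: "nat \<Rightarrow> nat set set \<Rightarrow> (nat \<Rightarrow> real measure) \<Rightarrow> real" where
  "EoR n F D = (SUP A\<in>online_algs n F. EoR_alg n F D A)"

definition RoE :: "nat \<Rightarrow> nat set set \<Rightarrow> (nat \<Rightarrow> real measure) \<Rightarrow> real" where
  "RoE n F D = (SUP A\<in>online_algs n F. RoE_alg n F D A)"

end

theory Submission
  imports Defs
begin

text \<open>Let \<open>t\<close> be the median of the largest weight among the elements lying in some feasible set,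
  and call \<open>M\<close> the mean of the optimum after zeroing all weights above \<open>t\<close>. Accepting the first
  element above \<open>t\<close> earns at least \<open>t / 2\<close>, and at least half of the total mean of the weights
  above \<open>t\<close>. The truncated optimum is self-bounding, so its variance is at most \<open>t * M\<close>
  (Efron--Stein). Hence \<open>ALG / f\<close>, which is at most \<open>2 * ALG / M\<close> when the truncated optimum
  exceeds \<open>M / 2\<close> and at most \<open>1\<close> otherwise, has mean at most \<open>2 * E[ALG] / M + 4 * t / M\<close>.
  As \<open>E[f]\<close> is at most \<open>M\<close> plus the tail, \<open>EoR\<close> is at most \<open>12 * RoE\<close>.\<close>

subsection \<open>A one-sided Efron--Stein inequality\<close>

text \<open>Variance bound by induction on the coordinates. Integrating out the newest coordinate
  splits the variance into a part within the sections and the variance of the section mean. Within a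
  section, the variance is at most the second moment about the reset value, and a drop lying in
  \<open>[0, t]\<close> has square at most \<open>t\<close> times itself. The section mean inherits
  the drop bounds, so the induction hypothesis covers the rest.\<close>

lemma (in product_prob_space) integral_power2_PiM_le:
  fixes g :: "('i \<Rightarrow> 'a) \<Rightarrow> real"
  assumes "finite J" "g \<in> borel_measurable (PiM J M)"
    and "\<And>w. w \<in> space (PiM J M) \<Longrightarrow> \<bar>g w\<bar> \<le> B"
    and "\<And>j. j \<in> J \<Longrightarrow> z j \<in> space (M j)"
    and "\<And>j w. j \<in> J \<Longrightarrow> w \<in> space (PiM J M) \<Longrightarrow>
      0 \<le> g w - g (w(j := z j)) \<and> g w - g (w(j := z j)) \<le> t"
  shows "(\<integral>w. (g w)\<^sup>2 \<partial>PiM J M)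
    \<le> (\<integral>w. g w \<partial>PiM J M)\<^sup>2 + t * (\<Sum>j\<in>J. \<integral>w. g w - g (w(j := z j)) \<partial>PiM J M)"
  using assms
proof (induction J arbitrary: g rule: finite_induct)
  case empty
  interpret PJ: prob_space "PiM {} M" by (rule prob_space_PiM) (rule prob_space)
  \<comment> \<open>The empty product space has a single point,
    \<open>\<lambda>_. undefined\<close>, so \<open>g\<close> is constant there.\<close>
  have "(\<integral>w. (g w)\<^sup>2 \<partial>PiM {} M) = (\<integral>w. (g (\<lambda>_. undefined))\<^sup>2 \<partial>PiM {} M)"
    "(\<integral>w. g w \<partial>PiM {} M) = (\<integral>w. g (\<lambda>_. undefined) \<partial>PiM {} M)"
    by (intro Bochner_Integration.integral_cong; simp add: space_PiM)+
  then show ?case by (simp add: PJ.prob_space)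
next
  case (insert i J)
  note [measurable] = insert.prems(1)
  let ?K = "insert i J"
  interpret PJ: prob_space "PiM J M" by (rule prob_space_PiM) (rule prob_space)
  interpret PK: prob_space "PiM ?K M" by (rule prob_space_PiM) (rule prob_space)
  have upd_space: "x(i := y) \<in> space (PiM ?K M)"
    if "x \<in> space (PiM J M)" "y \<in> space (M i)" for x y
    using that by (auto simp: space_PiM PiE_def extensional_def Pi_def)
  have reset_space: "w(j := z j) \<in> space (PiM A M)"
    if "w \<in> space (PiM A M)" "j \<in> A" "A \<subseteq> ?K" for w j A
    using that insert.prems(3) by (auto simp: space_PiM PiE_def extensional_def Pi_def)
  have upd_meas [measurable]: "(\<lambda>(x, y). x(i := y)) \<in> PiM J M \<Otimes>\<^sub>M M i \<rightarrow>\<^sub>M PiM ?K M"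
    by (rule measurable_add_dim)
  have reset_meas [measurable]: "(\<lambda>w. w(j := z j)) \<in> PiM A M \<rightarrow>\<^sub>M PiM A M"
    if "j \<in> A" "A \<subseteq> ?K" for j A
    using that insert.prems(3)
    by (intro measurable_fun_upd[where J = A] measurable_const) auto
  have g_upd [measurable]: "(\<lambda>(x, y). g (x(i := y))) \<in> borel_measurable (PiM J M \<Otimes>\<^sub>M M i)"
    using measurable_compose[OF upd_meas insert.prems(1)] by (simp add: split_beta)
  have g_sec [measurable]: "(\<lambda>y. g (x(i := y))) \<in> borel_measurable (M i)"
    if "x \<in> space (PiM J M)" for x
    using measurable_compose[OF measurable_Pair1'[OF that] g_upd] by simp
  have int_sec: "integrable (M i) (\<lambda>y. g (x(i := y)))"
    if "x \<in> space (PiM J M)" for x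
    using that insert.prems(2) upd_space
    by (intro M.integrable_const_bound[where B = B]) auto
  have sq_le: "(g w)\<^sup>2 \<le> B\<^sup>2" if "w \<in> space (PiM ?K M)" for w
    using insert.prems(2)[OF that] by (metis abs_ge_zero power2_abs power_mono)
  have int_sec2: "integrable (M i) (\<lambda>y. (g (x(i := y)))\<^sup>2)"
    if "x \<in> space (PiM J M)" for x
    using that sq_le upd_space
    by (intro M.integrable_const_bound[where B = "B\<^sup>2"]) auto
  have int_g: "integrable (PiM ?K M) g"
    using insert.prems(2) by (intro PK.integrable_const_bound[where B = B]) auto
  have int_g2: "integrable (PiM ?K M) (\<lambda>w. (g w)\<^sup>2)"
    using sq_le by (intro PK.integrable_const_bound[where B = "B\<^sup>2"]) auto
  have int_gz: "integrable (PiM ?K M) (\<lambda>w. g (w(j := z j)))" if "j \<in> ?K" for j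
    using insert.prems(2) reset_space that
    by (intro PK.integrable_const_bound[where B = B] AE_I2 measurable_compose[OF reset_meas]) auto
  \<comment> \<open>\<open>h\<close> is the mean of \<open>g\<close> over the section in coordinate
    \<open>i\<close>, and \<open>a\<close> is its value at the reset point \<open>z i\<close>.
    Resets at \<open>j \<in> J\<close> commute with inserting coordinate \<open>i\<close>, so they
    pass under the integral that defines \<open>h\<close>.\<close>
  define h where "h x = (\<integral>y. g (x(i := y)) \<partial>M i)" for x
  define a where "a x = g (x(i := z i))" for x
  have h_meas [measurable]: "h \<in> borel_measurable (PiM J M)"
    unfolding h_def by measurable
  have h_bd: "\<bar>h x\<bar> \<le> B" if "x \<in> space (PiM J M)" for x
  proof -
    have "\<bar>h x\<bar> \<le> (\<integral>y. \<bar>g (x(i := y))\<bar> \<partial>M i)"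
      unfolding h_def by (rule integral_abs_bound)
    also have "\<dots> \<le> B"
      using insert.prems(2) upd_space that int_sec
      by (intro M.integral_le_const AE_I2 integrable_abs) auto
    finally show ?thesis .
  qed
  have int_sec_z: "integrable (M i) (\<lambda>y. g ((x(i := y))(j := z j)))"
    and h_upd: "h (x(j := z j)) = (\<integral>y. g ((x(i := y))(j := z j)) \<partial>M i)"
    if "x \<in> space (PiM J M)" "j \<in> J" for x j
  proof -
    have "i \<noteq> j" using that insert.hyps by auto
    then have "(x(j := z j))(i := y) = (x(i := y))(j := z j)" for y
      by (simp add: fun_upd_twist)
    then show "integrable (M i) (\<lambda>y. g ((x(i := y))(j := z j)))"
      and "h (x(j := z j)) = (\<integral>y. g ((x(i := y))(j := z j)) \<partial>M i)"
      using int_sec[of "x(j := z j)"] reset_space[of x J j] that by (auto simp: h_def)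
  qed
  have h_z: "h x - h (x(j := z j)) = (\<integral>y. g (x(i := y)) - g ((x(i := y))(j := z j)) \<partial>M i)"
    if "x \<in> space (PiM J M)" "j \<in> J" for x j
    using that int_sec int_sec_z by (simp add: h_upd) (simp add: h_def)
  have h_diff: "0 \<le> h x - h (x(j := z j)) \<and> h x - h (x(j := z j)) \<le> t"
    if "j \<in> J" "x \<in> space (PiM J M)" for x j
  proof -
    have *: "0 \<le> g (x(i := y)) - g ((x(i := y))(j := z j)) \<and>
        g (x(i := y)) - g ((x(i := y))(j := z j)) \<le> t" if "y \<in> space (M i)" for y
      using insert.prems(4)[OF _ upd_space] \<open>j \<in> J\<close> \<open>x \<in> space (PiM J M)\<close> that by blast
    show ?thesis
      unfolding h_z[OF that(2,1)] using that * int_sec int_sec_z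
      by (intro conjI M.integral_le_const Bochner_Integration.integral_nonneg AE_I2) auto
  qed
  have a_meas [measurable]: "a \<in> borel_measurable (PiM J M)"
    unfolding a_def
    by (rule measurable_compose[OF _ insert.prems(1)], rule measurable_fun_upd[where J = J])
      (use insert.prems(3) in auto)
  have a_bd: "\<bar>a x\<bar> \<le> B" if "x \<in> space (PiM J M)" for x
    using that insert.prems(2,3) upd_space unfolding a_def by auto
  have int_h: "integrable (PiM J M) h"
    using h_bd by (intro PJ.integrable_const_bound[where B = B]) auto
  have int_a: "integrable (PiM J M) a"
    using a_bd by (intro PJ.integrable_const_bound[where B = B]) auto
  have int_h2: "integrable (PiM J M) (\<lambda>x. (h x)\<^sup>2)"
  proof (rule PJ.integrable_const_bound[where B = "B\<^sup>2"])
    show "AE x in PiM J M. norm ((h x)\<^sup>2) \<le> B\<^sup>2"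
      using h_bd by (intro AE_I2) (metis abs_ge_zero norm_power power2_abs power_mono real_norm_def)
  qed measurable
  have sec_le: "(\<integral>y. (g (x(i := y)))\<^sup>2 \<partial>M i) \<le> (h x)\<^sup>2 + t * (h x - a x)"
    if x: "x \<in> space (PiM J M)" for x
  proof -
    \<comment> \<open>Expanding \<open>(g - a)\<^sup>2 \<le> t * (g - a)\<close> bounds the square
      by a function affine in \<open>g\<close>, whose section integral involves only
      \<open>h x\<close>. The last estimate is
      \<open>2 * a * h - a\<^sup>2 \<le> h\<^sup>2\<close>.\<close>
    have "(\<integral>y. (g (x(i := y)))\<^sup>2 \<partial>M i)
        \<le> (\<integral>y. 2 * a x * g (x(i := y)) - (a x)\<^sup>2 + t * (g (x(i := y)) - a x) \<partial>M i)"
    proof (rule integral_mono)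
      fix y assume y: "y \<in> space (M i)"
      have "(g (x(i := y)) - a x)\<^sup>2 \<le> t * (g (x(i := y)) - a x)"
        using insert.prems(4)[OF insertI1 upd_space[OF x y]]
        unfolding a_def power2_eq_square fun_upd_upd by (elim conjE) (rule mult_right_mono)
      then show "(g (x(i := y)))\<^sup>2 \<le>
          2 * a x * g (x(i := y)) - (a x)\<^sup>2 + t * (g (x(i := y)) - a x)"
        by (simp add: power2_diff algebra_simps)
    qed (use x int_sec int_sec2 in auto)
    also have "\<dots> = 2 * a x * h x - (a x)\<^sup>2 + t * (h x - a x)"
      using int_sec[OF x] by (simp add: h_def M.prob_space)
    also have "\<dots> \<le> (h x)\<^sup>2 + t * (h x - a x)"
      using zero_le_power2[of "h x - a x"] by (simp add: power2_diff algebra_simps)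
    finally show ?thesis .
  qed
  have Eg: "(\<integral>w. g w \<partial>PiM ?K M) = (\<integral>x. h x \<partial>PiM J M)"
    unfolding h_def using insert.hyps int_g by (rule product_integral_insert)
  have Ez: "(\<integral>w. g w - g (w(j := z j)) \<partial>PiM ?K M) = (\<integral>x. h x - h (x(j := z j)) \<partial>PiM J M)"
    if "j \<in> J" for j
    using that insert.hyps int_g int_gz
    by (subst product_integral_insert) (auto intro!: Bochner_Integration.integral_cong simp: h_z)
  have Ei: "(\<integral>w. g w - g (w(i := z i)) \<partial>PiM ?K M) = (\<integral>x. h x - a x \<partial>PiM J M)"
    using insert.hyps int_g int_gz int_sec
    by (subst product_integral_insert)
      (auto intro!: Bochner_Integration.integral_cong simp: h_def a_def M.prob_space)
  have "(\<integral>w. (g w)\<^sup>2 \<partial>PiM ?K M) = (\<integral>x. \<integral>y. (g (x(i := y)))\<^sup>2 \<partial>M i \<partial>PiM J M)"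
    using insert.hyps int_g2 by (rule product_integral_insert)
  also have "\<dots> \<le> (\<integral>x. (h x)\<^sup>2 + t * (h x - a x) \<partial>PiM J M)"
  \<comment> \<open>This rule asks for integrability of the upper bound only, in exchange for its
    nonnegativity, which follows from \<open>sec_le\<close>.\<close>
  proof (rule integral_mono')
    show "integrable (PiM J M) (\<lambda>x. (h x)\<^sup>2 + t * (h x - a x))"
      using int_h int_h2 int_a by auto
    fix x assume x: "x \<in> space (PiM J M)"
    show "(\<integral>y. (g (x(i := y)))\<^sup>2 \<partial>M i) \<le> (h x)\<^sup>2 + t * (h x - a x)"
      using x by (rule sec_le)
    have "0 \<le> (\<integral>y. (g (x(i := y)))\<^sup>2 \<partial>M i)" by simp
    then show "0 \<le> (h x)\<^sup>2 + t * (h x - a x)" using sec_le[OF x] by linarith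
  qed
  also have "\<dots> = (\<integral>x. (h x)\<^sup>2 \<partial>PiM J M) + t * (\<integral>x. h x - a x \<partial>PiM J M)"
    using int_h int_h2 int_a by simp
  also have "\<dots> \<le> (\<integral>x. h x \<partial>PiM J M)\<^sup>2
      + t * (\<Sum>j\<in>J. \<integral>x. h x - h (x(j := z j)) \<partial>PiM J M) + t * (\<integral>x. h x - a x \<partial>PiM J M)"
    using insert.IH[OF h_meas h_bd insert.prems(3)[OF insertI2] h_diff] by (rule add_right_mono)
  also have "\<dots> = (\<integral>w. g w \<partial>PiM ?K M)\<^sup>2
      + t * (\<Sum>j\<in>?K. \<integral>w. g w - g (w(j := z j)) \<partial>PiM ?K M)"
    using insert.hyps Eg Ez Ei by (simp add: algebra_simps)
  finally show ?case .
qed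

subsection \<open>The offline optimum and the threshold algorithm\<close>

lemma sum_le_offline_opt:
  assumes "finite F" "S \<in> F"
  shows "sum w S \<le> offline_opt F w"
  unfolding offline_opt_def using assms by (intro Max_ge) auto

lemma offline_opt_attained:
  assumes "finite F" "F \<noteq> {}"
  obtains S where "S \<in> F" "offline_opt F w = sum w S"
proof -
  have "offline_opt F w \<in> (\<lambda>S. sum w S) ` F"
    unfolding offline_opt_def using assms by (intro Max_in) auto
  then show ?thesis using that by auto
qed

lemma offline_opt_mono:
  assumes "finite F" "F \<noteq> {}" "\<And>e. e \<in> \<Union>F \<Longrightarrow> v e \<le> w e"
  shows "offline_opt F v \<le> offline_opt F w"
proof -
  obtain S where S: "S \<in> F" "offline_opt F v = sum v S"
    using assms offline_opt_attained by blast
  have "sum v S \<le> sum w S" using assms S by (intro sum_mono) auto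
  also have "\<dots> \<le> offline_opt F w" using assms S by (intro sum_le_offline_opt)
  finally show ?thesis using S by simp
qed

text \<open>A set optimal for \<open>w\<close> is a candidate for \<open>v\<close>, and the surplus
  \<open>r\<close> collected on it is at most the surplus of all usable elements. This gives the
  split of the optimum into core and tail.\<close>

lemma offline_opt_le_add_sum:
  assumes "finite F" "F \<noteq> {}" "finite (\<Union>F)" "\<And>e. e \<in> \<Union>F \<Longrightarrow> 0 \<le> r e"
    "\<And>e. e \<in> \<Union>F \<Longrightarrow> w e \<le> v e + r e"
  shows "offline_opt F w \<le> offline_opt F v + sum r (\<Union>F)"
proof -
  obtain S where S: "S \<in> F" "offline_opt F w = sum w S"
    using assms offline_opt_attained by blast
  have "sum w S \<le> (\<Sum>e\<in>S. v e + r e)" using assms S by (intro sum_mono) auto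
  also have "\<dots> = sum v S + sum r S" by (rule sum.distrib)
  also have "\<dots> \<le> offline_opt F v + sum r (\<Union>F)"
    using assms S by (intro add_mono sum_le_offline_opt sum_mono2) auto
  finally show ?thesis using S by simp
qed

lemma offline_opt_nonneg: "finite F \<Longrightarrow> {} \<in> F \<Longrightarrow> 0 \<le> offline_opt F w"
  using sum_le_offline_opt[of F "{}" w] by simp

lemma sum_fun_upd_zero:
  fixes v :: "'a \<Rightarrow> real"
  assumes "finite S"
  shows "sum (v(j := 0)) S = sum v S - (if j \<in> S then v j else 0)"
proof -
  have "sum (v(j := 0)) S = (\<Sum>e\<in>S. v e - (if e = j then v j else 0))"
    by (intro sum.cong) auto
  then show ?thesis using assms by (simp add: sum_subtractf)
qed

text \<open>A set optimal for \<open>v\<close> stays feasible when \<open>j\<close> is zeroed and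
  loses at most \<open>v j\<close>. These are the drop bounds for the Efron--Stein inequality with
  reset value 0.\<close>

lemma offline_opt_drop_bounds:
  assumes "finite F" "F \<noteq> {}" "finite (\<Union>F)" "\<And>e. 0 \<le> v e" "\<And>e. v e \<le> t"
  shows "0 \<le> offline_opt F v - offline_opt F (v(j := 0))"
    and "offline_opt F v - offline_opt F (v(j := 0)) \<le> t"
proof -
  show "0 \<le> offline_opt F v - offline_opt F (v(j := 0))"
    using offline_opt_mono[of F "v(j := 0)" v] assms by simp
  obtain S where S: "S \<in> F" "offline_opt F v = sum v S"
    using assms offline_opt_attained by blast
  then have "finite S" using assms(3) finite_subset[of S "\<Union>F"] by auto
  moreover have "0 \<le> t" using assms(4,5) order_trans by blast
  ultimately show "offline_opt F v - offline_opt F (v(j := 0)) \<le> t"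
    using S(2) sum_le_offline_opt[OF assms(1) S(1), of "v(j := 0)", unfolded sum_fun_upd_zero[OF \<open>finite S\<close>]]
      assms(4,5)[of j] by (auto split: if_splits)
qed

text \<open>Self-bounding property. One optimal set \<open>S\<close> serves for every
  \<open>j\<close>: zeroing \<open>j\<close> costs nothing if \<open>j\<close> lies outside
  \<open>S\<close> and at most \<open>v j\<close> otherwise, so the costs add up to at most the
  weight of \<open>S\<close>.\<close>

lemma sum_offline_opt_drop_le:
  assumes "finite F" "F \<noteq> {}" "\<Union>F \<subseteq> J" "finite J" "\<And>e. 0 \<le> v e"
  shows "(\<Sum>j\<in>J. offline_opt F v - offline_opt F (v(j := 0))) \<le> offline_opt F v"
proof -
  obtain S where S: "S \<in> F" "offline_opt F v = sum v S"
    using assms offline_opt_attained by blast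
  then have "S \<subseteq> J" using assms(3) by auto
  then have fin: "finite S" using assms(4) finite_subset by auto
  have "(\<Sum>j\<in>J. offline_opt F v - offline_opt F (v(j := 0))) \<le> (\<Sum>j\<in>J. if j \<in> S then v j else 0)"
  proof (rule sum_mono)
    fix j
    show "offline_opt F v - offline_opt F (v(j := 0)) \<le> (if j \<in> S then v j else 0)"
      using S(2) sum_le_offline_opt[OF assms(1) S(1), of "v(j := 0)", unfolded sum_fun_upd_zero[OF fin]]
      by auto
  qed
  also have "\<dots> = sum v S"
    using \<open>S \<subseteq> J\<close> assms(4) by (simp add: sum.If_cases Int_absorb1)
  finally show ?thesis using S by simp
qed

text \<open>Large weights become 0 instead of \<open>t\<close>, so that a nonnegative weight is its
  truncation plus its part above \<open>t\<close>. Negative inputs also become 0, because the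
  Efron--Stein inequality needs its drop bounds at every point and not just almost
  everywhere.\<close>

definition trunc_at :: "real \<Rightarrow> real \<Rightarrow> real" where
  "trunc_at t x = (if 0 \<le> x \<and> x \<le> t then x else 0)"

lemma trunc_at_measurable [measurable]: "trunc_at t \<in> borel_measurable borel"
  unfolding trunc_at_def[abs_def] by measurable

lemma trunc_at_bounds: "0 \<le> trunc_at t x" "0 \<le> t \<Longrightarrow> trunc_at t x \<le> t"
  "0 \<le> x \<Longrightarrow> trunc_at t x \<le> x"
  by (auto simp: trunc_at_def)

lemma trunc_at_fun_upd_zero: "(\<lambda>e. trunc_at t ((w(j := 0)) e)) = (\<lambda>e. trunc_at t (w e))(j := 0)"
  by (auto simp: trunc_at_def)

section \<open>Accepting the first usable element above a threshold\<close>

definition threshold_alg :: "nat set set \<Rightarrow> real \<Rightarrow> real \<Rightarrow> (nat \<Rightarrow> real) \<Rightarrow> nat set" where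
  "threshold_alg F t u w = {i \<in> \<Union>F. t < w i \<and> (\<forall>j \<in> \<Union>F. j < i \<longrightarrow> w j \<le> t)}"

text \<open>Of two accepted elements the later one would require the earlier to be at most
  \<open>t\<close>. The accepted element lies in some feasible set, so its singleton is feasible by
  downward closure.\<close>

lemma threshold_alg_cases:
  obtains "threshold_alg F t u w = {}"
  | i where "i \<in> \<Union>F" "t < w i" "threshold_alg F t u w = {i}"
proof (cases "threshold_alg F t u w = {}")
  case False
  then obtain i where i: "i \<in> threshold_alg F t u w" by blast
  have "j = i" if "j \<in> threshold_alg F t u w" for j
  proof (rule ccontr)
    assume "j \<noteq> i"
    then consider "i < j" | "j < i" by linarith
    then show False
    proof cases
      case 1
      then have "w i \<le> t" using i that unfolding threshold_alg_def by blast
      then show False using i by (simp add: threshold_alg_def)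
    next
      case 2
      then have "w j \<le> t" using i that unfolding threshold_alg_def by blast
      then show False using that by (simp add: threshold_alg_def)
    qed
  qed
  then have "threshold_alg F t u w = {i}" using i by blast
  moreover have "i \<in> \<Union>F" "t < w i" using i unfolding threshold_alg_def by blast+
  ultimately show thesis using that(2) by blast
qed

lemma threshold_alg_nonempty:
  assumes "i \<in> \<Union>F" "t < w i"
  shows "threshold_alg F t u w \<noteq> {}"
proof -
  define k where "k = (LEAST k. k \<in> \<Union>F \<and> t < w k)"
  have "k \<in> \<Union>F \<and> t < w k" unfolding k_def by (rule LeastI[of _ i]) (use assms in blast)
  moreover have "w j \<le> t" if "j \<in> \<Union>F" "j < k" for j
    using that not_less_Least[of j "\<lambda>k. k \<in> \<Union>F \<and> t < w k"] unfolding k_def by force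
  ultimately have "k \<in> threshold_alg F t u w" by (auto simp: threshold_alg_def)
  then show ?thesis by blast
qed

lemma threshold_alg_online:
  assumes "F \<subseteq> Pow {0..<n}" "downward_closed F" "{} \<in> F"
  shows "threshold_alg F t \<in> online_algs n F"
  unfolding online_algs_def
proof (intro CollectI conjI allI impI)
  fix u :: real and w :: "nat \<Rightarrow> real"
  show "threshold_alg F t u w \<in> F"
  proof (cases rule: threshold_alg_cases[of F t u w])
    case (2 i)
    then obtain S where "S \<in> F" "{i} \<subseteq> S" by blast
    then show ?thesis using assms(2) 2(3) unfolding downward_closed_def by metis
  qed (use assms in simp)
next
  fix u :: real and w w' :: "nat \<Rightarrow> real" and i assume "\<forall>j\<le>i. w j = w' j"
  then show "i \<in> threshold_alg F t u w \<longleftrightarrow> i \<in> threshold_alg F t u w'"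
    by (simp add: threshold_alg_def)
next
  fix i assume "i < n"
  have UF: "\<Union>F \<subseteq> {0..<n}" using assms(1) by blast
  then have fin: "finite (\<Union>F)" by (rule finite_subset) simp
  have sub: "j < n" if "j \<in> \<Union>F" for j using subsetD[OF UF that] by simp
  let ?B = "borel \<Otimes>\<^sub>M PiM {0..<n} (\<lambda>_. borel) :: (real \<times> (nat \<Rightarrow> real)) measure"
  have [measurable]: "(\<lambda>x. snd x j) \<in> borel_measurable ?B" if "j < n" for j
    by (rule measurable_compose[OF measurable_snd measurable_component_singleton]) (use that in simp)
  have "(\<lambda>(u, w). indicator (threshold_alg F t u w) i :: real) =
      (\<lambda>x. if i \<in> \<Union>F \<and> t < snd x i \<and> (\<forall>j\<in>{j\<in>\<Union>F. j < i}. snd x j \<le> t) then 1 else 0)"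
    by (rule ext) (simp add: split_beta indicator_def threshold_alg_def, blast)
  also have "\<dots> \<in> borel_measurable ?B"
  proof (rule measurable_If)
    have "{x \<in> space ?B. t < snd x i} \<in> sets ?B"
      using \<open>i < n\<close> by measurable
    moreover have "{x \<in> space ?B. \<forall>j\<in>{j\<in>\<Union>F. j < i}. snd x j \<le> t} \<in> sets ?B"
    proof (rule sets.sets_Collect_finite_All)
      show "{x \<in> space ?B. snd x j \<le> t} \<in> sets ?B" if "j \<in> {j\<in>\<Union>F. j < i}" for j
      proof -
        have "j < n" using sub that by blast
        then show ?thesis by measurable
      qed
    qed (use fin in auto)
    ultimately show "{x \<in> space ?B. i \<in> \<Union>F \<and> t < snd x i \<and>
        (\<forall>j\<in>{j\<in>\<Union>F. j < i}. snd x j \<le> t)} \<in> sets ?B"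
      by (intro sets.sets_Collect_conj sets.sets_Collect_const)
  qed auto
  finally show "(\<lambda>(u, w). indicator (threshold_alg F t u w) i :: real) \<in> borel_measurable ?B" .
qed

text \<open>Both lower bounds are built from products of functions of single coordinates, so that
  their means factor by independence. In the first, the product indicates that nothing exceeds
  \<open>t\<close>. In the second, a summand is nonzero only if its element is the only one above
  \<open>t\<close>.\<close>

lemma alg_value_threshold_ge:
  assumes "finite (\<Union>F)" "0 \<le> t" "\<And>e. e \<in> \<Union>F \<Longrightarrow> 0 \<le> w e"
  shows "t * (1 - (\<Prod>j\<in>\<Union>F. indicator {..t} (w j))) \<le> alg_value (threshold_alg F t) u w"
    and "(\<Sum>i\<in>\<Union>F. indicator {t<..} (w i) * w i * (\<Prod>j\<in>\<Union>F - {i}. indicator {..t} (w j)))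
      \<le> alg_value (threshold_alg F t) u w" (is "?L \<le> _")
proof -
  show "t * (1 - (\<Prod>j\<in>\<Union>F. indicator {..t} (w j))) \<le> alg_value (threshold_alg F t) u w"
  proof (cases rule: threshold_alg_cases[of F t u w])
    case 1
    then have "(\<Prod>j\<in>\<Union>F. indicator {..t} (w j) :: real) = 1"
      using threshold_alg_nonempty[of _ F t w u]
      by (intro prod.neutral ballI) (metis atMost_iff indicator_simps(1) not_less)
    then show ?thesis using 1 by (simp add: alg_value_def)
  next
    case (2 i)
    then have "(\<Prod>j\<in>\<Union>F. indicator {..t} (w j) :: real) = 0"
      using assms(1) by (intro prod_zero bexI[of _ i]) (simp_all add: indicator_def)
    then show ?thesis using 2 by (simp add: alg_value_def)
  qed
  show "?L \<le> alg_value (threshold_alg F t) u w"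
  proof (cases rule: threshold_alg_cases[of F t u w])
    case 1
    then have "w i \<le> t" if "i \<in> \<Union>F" for i
      using that threshold_alg_nonempty[of i F t w u] by force
    then have "?L = 0" by (intro sum.neutral ballI) (simp add: not_less)
    then show ?thesis using 1 by (simp add: alg_value_def)
  next
    case (2 i)
    \<comment> \<open>For \<open>k\<close> other than the accepted \<open>i\<close>, the product
      contains the factor of \<open>i\<close>, which is 0.\<close>
    have "indicator {t<..} (w k) * w k * (\<Prod>j\<in>\<Union>F - {k}. indicator {..t} (w j)) = 0"
      if "k \<in> \<Union>F - {i}" for k
    proof -
      have "(\<Prod>j\<in>\<Union>F - {k}. indicator {..t} (w j) :: real) = 0"
        using assms(1) 2(1,2) that by (intro prod_zero bexI[of _ i]) (simp_all add: indicator_def)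
      then show ?thesis by simp
    qed
    then have "?L = indicator {t<..} (w i) * w i * (\<Prod>j\<in>\<Union>F - {i}. indicator {..t} (w j))"
      by (subst sum.remove[OF assms(1) 2(1)]) (subst sum.neutral, blast, rule add_0_right)
    also have "\<dots> \<le> w i * 1"
    proof -
      have "(\<Prod>j\<in>\<Union>F - {i}. indicator {..t} (w j) :: real) \<le> 1"
        by (intro prod_le_1) (simp add: indicator_def)
      then show ?thesis using assms(3)[OF 2(1)] 2(2) by (simp add: mult_left_le)
    qed
    finally show ?thesis using 2 by (simp add: alg_value_def)
  qed
qed

text \<open>The product is the distribution function of the maximum of independent variables. It is
  continuous because there are no atoms, vanishes at 0, and tends to 1, so the intermediate value
  theorem applies.\<close>

lemma prod_cdf_median:
  fixes D :: "'a \<Rightarrow> real measure"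
  assumes "finite U" "U \<noteq> {}" "\<And>i. i \<in> U \<Longrightarrow> real_distribution (D i)"
    "\<And>i x. i \<in> U \<Longrightarrow> measure (D i) {x} = 0"
    "\<And>i. i \<in> U \<Longrightarrow> AE x in D i. 0 \<le> x"
  obtains t where "0 \<le> t" "(\<Prod>i\<in>U. measure (D i) {..t}) = 1/2"
proof -
  define G where "G x = (\<Prod>i\<in>U. cdf (D i) x)" for x
  have cont: "isCont G x" for x
    unfolding G_def[abs_def]
  proof (intro continuous_intros)
    fix i assume i: "i \<in> U"
    interpret real_distribution "D i" using assms(3) i .
    show "isCont (cdf (D i)) x" using assms(4)[OF i] by (simp add: isCont_cdf)
  qed
  have "(G \<longlongrightarrow> (\<Prod>i\<in>U. 1)) at_top"
    unfolding G_def[abs_def]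
    by (intro tendsto_prod real_distribution.cdf_lim_at_top_prob assms)
  then have "eventually (\<lambda>x. 1/2 < G x) at_top"
    by (rule order_tendstoD) simp
  then obtain b where b: "0 \<le> b" "1/2 < G b"
    by (metis (mono_tags, lifting) eventually_at_top_linorder max.cobounded1 max.cobounded2)
  \<comment> \<open>A single factor suffices: nonnegativity removes the mass below 0, and the
    absence of atoms removes the mass at 0.\<close>
  have "G 0 = 0"
  proof -
    obtain i where i: "i \<in> U" using assms by auto
    interpret real_distribution "D i" using assms(3) i .
    have "{..0::real} = {..<0} \<union> {0}" by auto
    then have "measure (D i) {..0} \<le> measure (D i) {..<0} + measure (D i) {0}"
      by (simp only:) (rule measure_subadditive; simp)
    moreover have "AE x in D i. \<not> x < 0" using assms(5)[OF i] by eventually_elim simp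
    then have "measure (D i) {..<0} = 0"
      by (intro prob_eq_0[THEN iffD2]) auto
    ultimately have "measure (D i) {..0} = 0"
      using assms(4)[OF i] by (simp add: measure_le_0_iff)
    then show ?thesis unfolding G_def cdf_def using i assms(1) by (intro prod_zero) auto
  qed
  moreover have "continuous_on {0..b} G"
    using cont by (simp add: continuous_at_imp_continuous_on)
  ultimately have "\<exists>t\<ge>0. t \<le> b \<and> G t = 1/2"
    using b by (intro IVT') auto
  then obtain t where "0 \<le> t" "G t = 1/2" by blast
  then show thesis using that by (simp add: G_def cdf_def)
qed

subsection \<open>Comparing the two ratios\<close>

text \<open>Lets statements about the weights alone be moved to the joint space of seed and
  weights.\<close>

lemma distr_snd_pair:
  assumes "prob_space M" "prob_space N"
  shows "distr (M \<Otimes>\<^sub>M N) N snd = N"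
proof (rule measure_eqI)
  interpret M: prob_space M by fact
  interpret N: prob_space N by fact
  fix A assume "A \<in> sets (distr (M \<Otimes>\<^sub>M N) N snd)"
  then have A: "A \<in> sets N" by simp
  have "snd -` A \<inter> space (M \<Otimes>\<^sub>M N) = space M \<times> A"
    using sets.sets_into_space[OF A] by (auto simp: space_pair_measure)
  then show "emeasure (distr (M \<Otimes>\<^sub>M N) N snd) A = emeasure N A"
    using A by (simp add: emeasure_distr N.emeasure_pair_measure_Times M.emeasure_space_1)
qed simp

text \<open>The probability and \<open>sets_D\<close> conditions range over all indices, as
  \<open>product_prob_space\<close> fixes a measure for each one; the other conditions on
  \<open>D\<close> concern only \<open>i < n\<close>.\<close>

locale prophet = product_prob_space D "{0..<n}" for D :: "nat \<Rightarrow> real measure" and n :: nat +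
  fixes F :: "nat set set"
  assumes feasible_subset: "F \<subseteq> Pow {0..<n}"
    and down_closed: "downward_closed F"
    and empty_feasible: "{} \<in> F"
    and sets_D [measurable_cong, simp]: "sets (D i) = sets borel"
    and D_nonneg: "i < n \<Longrightarrow> AE x in D i. 0 \<le> x"
    and D_no_atoms: "i < n \<Longrightarrow> measure (D i) {x} = 0"
    and D_integrable: "i < n \<Longrightarrow> integrable (D i) (\<lambda>x. x)"
begin

section \<open>Transfer between marginals, weights and the joint space; measurability and
  integrability\<close>

abbreviation U :: "nat set" where "U \<equiv> \<Union>F"
abbreviation W :: "(nat \<Rightarrow> real) measure" where "W \<equiv> PiM {0..<n} D"
abbreviation SW :: "(real \<times> (nat \<Rightarrow> real)) measure" where "SW \<equiv> seed_space \<Otimes>\<^sub>M W"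

lemma U_subset: "U \<subseteq> {0..<n}" using feasible_subset by blast
lemma U_less: "i \<in> U \<Longrightarrow> i < n" using U_subset by (meson atLeastLessThan_iff subsetD)
lemma finite_U: "finite U" using U_subset finite_subset by blast
lemma finite_F: "finite F" using feasible_subset finite_subset by blast
lemma F_ne: "F \<noteq> {}" using empty_feasible by auto
lemma space_D [simp]: "space (D i) = UNIV" using sets_eq_imp_space_eq[OF sets_D] by simp

lemma real_distribution_D: "real_distribution (D i)"
  by (simp add: real_distribution_def real_distribution_axioms_def prob_space)

lemma prob_space_seed: "prob_space seed_space"
  unfolding seed_space_def by (rule prob_space_uniform_measure) auto

lemma prob_space_W: "prob_space W"
  by (rule prob_space_PiM) (rule prob_space)

lemma prob_space_SW: "prob_space SW"
  using prob_space_seed prob_space_W by (rule prob_space_pair)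

lemma snd_SW: "distr SW W snd = W"
  using prob_space_seed prob_space_W by (rule distr_snd_pair)

lemma coord_meas [measurable]: "i < n \<Longrightarrow> (\<lambda>w. w i) \<in> borel_measurable W"
  using measurable_component_singleton[of i "{0..<n}" D] by simp

lemma offline_opt_meas [measurable]: "offline_opt F \<in> borel_measurable W"
  unfolding offline_opt_def[abs_def]
proof (rule borel_measurable_Max)
  show "(\<lambda>w. sum w S) \<in> borel_measurable W" if "S \<in> F" for S
    using that U_less by (intro borel_measurable_sum coord_meas) auto
qed (rule finite_F)

lemma integral_SW:
  fixes h :: "(nat \<Rightarrow> real) \<Rightarrow> real"
  assumes "h \<in> borel_measurable W"
  shows "(\<integral>x. h (snd x) \<partial>SW) = (\<integral>w. h w \<partial>W)"
  using integral_distr[of snd SW W h] assms by (simp add: snd_SW)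

lemma integrable_SW:
  fixes h :: "(nat \<Rightarrow> real) \<Rightarrow> real"
  assumes "integrable W h"
  shows "integrable SW (\<lambda>x. h (snd x))"
  using integrable_distr[of snd SW W h] assms by (simp add: snd_SW)

lemma AE_SW:
  assumes "AE w in W. Q w"
  shows "AE x in SW. Q (snd x)"
proof (rule AE_distrD[OF measurable_snd])
  show "AE w in distr SW W snd. Q w" using assms by (subst snd_SW)
qed

lemma borel_measurable_D: "h \<in> borel_measurable borel \<Longrightarrow> h \<in> borel_measurable (D i)"
  using measurable_cong_sets[OF sets_D refl, of i borel] by blast

lemma AE_nonneg: "AE w in W. \<forall>i\<in>{0..<n}. 0 \<le> w i"
  by (intro AE_finite_allI AE_PiM_component prob_space D_nonneg) auto

lemma integrable_component:
  fixes h :: "real \<Rightarrow> real"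
  assumes "i < n" "integrable (D i) h"
  shows "integrable W (\<lambda>w. h (w i))"
proof -
  have "integrable (distr W (D i) (\<lambda>w. w i)) h"
    using assms PiM_component[of i] by simp
  then show ?thesis
    using assms by (subst (asm) integrable_distr_eq) auto
qed

lemma integral_component:
  fixes h :: "real \<Rightarrow> real"
  assumes "i < n" "h \<in> borel_measurable borel"
  shows "(\<integral>w. h (w i) \<partial>W) = integral\<^sup>L (D i) h"
proof -
  have "integral\<^sup>L (distr W (D i) (\<lambda>w. w i)) h = (\<integral>w. h (w i) \<partial>W)"
    using assms by (intro integral_distr borel_measurable_D) auto
  then show ?thesis using assms PiM_component[of i] by simp
qed

lemma alg_value_meas [measurable]:
  assumes "A \<in> online_algs n F"
  shows "(\<lambda>x. alg_value A (fst x) (snd x)) \<in> borel_measurable SW"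
proof -
  have "sets SW = sets (borel \<Otimes>\<^sub>M PiM {0..<n} (\<lambda>_. borel))"
    by (intro sets_pair_measure_cong sets_PiM_cong) (auto simp: seed_space_def)
  then have ind: "(\<lambda>x. indicator (A (fst x) (snd x)) i :: real) \<in> borel_measurable SW" if "i < n" for i
    using assms that unfolding online_algs_def
    by (simp add: case_prod_beta' cong: measurable_cong_sets)
  \<comment> \<open>Only the acceptance indicators are known to be measurable, so the value is
    rewritten as a sum over all elements weighted by them.\<close>
  have "(\<lambda>x. \<Sum>i\<in>{0..<n}. indicator (A (fst x) (snd x)) i * snd x i) \<in> borel_measurable SW"
    by (intro borel_measurable_sum borel_measurable_times ind
        measurable_compose[OF measurable_snd coord_meas]) auto
  also have "(\<lambda>x. \<Sum>i\<in>{0..<n}. indicator (A (fst x) (snd x)) i * snd x i)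
      = (\<lambda>x. alg_value A (fst x) (snd x))"
  proof
    fix x
    have "A (fst x) (snd x) \<subseteq> {0..<n}"
      using assms feasible_subset unfolding online_algs_def by blast
    then show "(\<Sum>i\<in>{0..<n}. indicator (A (fst x) (snd x)) i * snd x i) = alg_value A (fst x) (snd x)"
      unfolding alg_value_def by (simp add: indicator_def sum.If_cases Int_absorb1 if_distrib cong: if_cong)
  qed
  finally show ?thesis .
qed

lemma alg_value_le_offline_opt: "A \<in> online_algs n F \<Longrightarrow> alg_value A u w \<le> offline_opt F w"
  unfolding alg_value_def by (rule sum_le_offline_opt[OF finite_F]) (simp add: online_algs_def)

lemma alg_value_nonneg:
  assumes "A \<in> online_algs n F" "\<forall>i\<in>{0..<n}. 0 \<le> w i"
  shows "0 \<le> alg_value A u w"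
proof -
  have "A u w \<subseteq> {0..<n}" using assms feasible_subset unfolding online_algs_def by blast
  then show ?thesis using assms(2) unfolding alg_value_def by (intro sum_nonneg) auto
qed

lemma integrable_offline_opt: "integrable W (offline_opt F)"
proof (rule Bochner_Integration.integrable_bound)
  show "integrable W (\<lambda>w. \<Sum>i\<in>U. \<bar>w i\<bar>)"
    using U_less D_integrable
    by (intro Bochner_Integration.integrable_sum integrable_abs integrable_component) auto
  show "AE w in W. norm (offline_opt F w) \<le> norm (\<Sum>i\<in>U. \<bar>w i\<bar>)"
  proof (rule AE_I2)
    fix w :: "nat \<Rightarrow> real"
    obtain S where S: "S \<in> F" "offline_opt F w = sum w S"
      using offline_opt_attained finite_F F_ne by blast
    have "0 \<le> offline_opt F w"
      using finite_F empty_feasible by (rule offline_opt_nonneg)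
    moreover have "sum w S \<le> (\<Sum>i\<in>S. \<bar>w i\<bar>)" by (intro sum_mono) auto
    moreover have "\<dots> \<le> (\<Sum>i\<in>U. \<bar>w i\<bar>)" using S finite_U by (intro sum_mono2) auto
    ultimately show "norm (offline_opt F w) \<le> norm (\<Sum>i\<in>U. \<bar>w i\<bar>)" using S by simp
  qed
qed measurable

lemma AE_SW_nonneg: "AE x in SW. \<forall>i\<in>{0..<n}. 0 \<le> snd x i"
  using AE_nonneg by (rule AE_SW)

lemma integrable_alg_value:
  assumes "A \<in> online_algs n F"
  shows "integrable SW (\<lambda>x. alg_value A (fst x) (snd x))"
proof (rule Bochner_Integration.integrable_bound)
  show "integrable SW (\<lambda>x. offline_opt F (snd x))"
    using integrable_offline_opt by (rule integrable_SW)
  show "AE x in SW. norm (alg_value A (fst x) (snd x)) \<le> norm (offline_opt F (snd x))"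
    using AE_SW_nonneg
  proof eventually_elim
    case (elim x)
    show ?case
      using alg_value_nonneg[OF assms elim, of "fst x"]
        alg_value_le_offline_opt[OF assms, of "fst x" "snd x"] by simp
  qed
qed (use assms in measurable)

section \<open>Means of the algorithm and of the optimum, and the ratio of expectations\<close>

definition alg_mean :: "(real \<Rightarrow> (nat \<Rightarrow> real) \<Rightarrow> nat set) \<Rightarrow> real" where
  "alg_mean A = (\<integral>x. alg_value A (fst x) (snd x) \<partial>SW)"

definition opt_mean :: real where
  "opt_mean = (\<integral>w. offline_opt F w \<partial>W)"

lemma alg_mean_nonneg: "A \<in> online_algs n F \<Longrightarrow> 0 \<le> alg_mean A"
  unfolding alg_mean_def using AE_SW_nonneg
  by (intro integral_nonneg_AE) (auto elim!: eventually_mono intro: alg_value_nonneg)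

lemma alg_mean_le_opt_mean:
  assumes "A \<in> online_algs n F"
  shows "alg_mean A \<le> opt_mean"
proof -
  have "alg_mean A \<le> (\<integral>x. offline_opt F (snd x) \<partial>SW)"
    unfolding alg_mean_def using assms
    by (intro integral_mono integrable_alg_value integrable_SW integrable_offline_opt
        alg_value_le_offline_opt)
  then show ?thesis by (simp add: opt_mean_def integral_SW)
qed

lemma opt_mean_nonneg: "0 \<le> opt_mean"
  unfolding opt_mean_def
  by (intro Bochner_Integration.integral_nonneg offline_opt_nonneg finite_F empty_feasible)

lemma RoE_alg_eq: "RoE_alg n F D A = alg_mean A / opt_mean"
  by (simp add: RoE_alg_def alg_mean_def opt_mean_def case_prod_beta')

lemma RoE_alg_le_RoE:
  assumes "A \<in> online_algs n F"
  shows "RoE_alg n F D A \<le> RoE n F D"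
  unfolding RoE_def
\<comment> \<open>A supremum of reals needs an explicit upper bound; 1 works, including for
  denominator 0, where the quotient is 0.\<close>
proof (rule cSUP_upper[OF assms])
  show "bdd_above (RoE_alg n F D ` online_algs n F)"
    using alg_mean_le_opt_mean opt_mean_nonneg alg_mean_nonneg
    by (intro bdd_aboveI[of _ 1]) (auto simp: RoE_alg_eq divide_le_eq_1)
qed

text \<open>Product form of the supremum bound, free of division. If the optimum has mean 0, every
  algorithm earns at most 0 on average.\<close>

lemma alg_mean_le_RoE:
  assumes "A \<in> online_algs n F"
  shows "alg_mean A \<le> RoE n F D * opt_mean"
proof (cases "opt_mean = 0")
  case True
  then show ?thesis using alg_mean_le_opt_mean[OF assms] by simp
next
  case False
  then show ?thesis
    using RoE_alg_le_RoE[OF assms] opt_mean_nonneg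
    by (simp add: RoE_alg_eq divide_le_eq)
qed

lemma threshold_alg_in: "threshold_alg F t \<in> online_algs n F"
  using feasible_subset down_closed empty_feasible by (rule threshold_alg_online)

lemma RoE_nonneg: "0 \<le> RoE n F D"
proof -
  have "0 \<le> RoE_alg n F D (threshold_alg F 0)"
    using alg_mean_nonneg[OF threshold_alg_in] opt_mean_nonneg by (simp add: RoE_alg_eq)
  also have "\<dots> \<le> RoE n F D" by (rule RoE_alg_le_RoE[OF threshold_alg_in])
  finally show ?thesis .
qed

section \<open>The pointwise ratio and its expectation\<close>

lemma ratio_meas [measurable]:
  assumes "A \<in> online_algs n F"
  shows "(\<lambda>x. alg_value A (fst x) (snd x) / offline_opt F (snd x)) \<in> borel_measurable SW"
  using alg_value_meas[OF assms] measurable_compose[OF measurable_snd offline_opt_meas]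
  by (rule borel_measurable_divide)

lemma ratio_bounds:
  assumes "A \<in> online_algs n F" "\<forall>i\<in>{0..<n}. 0 \<le> w i"
  shows "0 \<le> alg_value A u w / offline_opt F w" "alg_value A u w / offline_opt F w \<le> 1"
  using alg_value_nonneg[OF assms, of u] alg_value_le_offline_opt[OF assms(1), of u w]
  by (auto simp: divide_le_eq_1)

lemma EoR_alg_eq:
  "EoR_alg n F D A = (\<integral>x. alg_value A (fst x) (snd x) / offline_opt F (snd x) \<partial>SW)"
  by (simp add: EoR_alg_def case_prod_beta')

lemma integrable_ratio:
  assumes "A \<in> online_algs n F"
  shows "integrable SW (\<lambda>x. alg_value A (fst x) (snd x) / offline_opt F (snd x))"
proof -
  interpret SW: prob_space SW by (rule prob_space_SW)
  have "AE x in SW. norm (alg_value A (fst x) (snd x) / offline_opt F (snd x)) \<le> 1"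
    using AE_SW_nonneg
    by eventually_elim (use ratio_bounds[OF assms] in \<open>simp only: real_norm_def abs_of_nonneg\<close>)
  then show ?thesis
    using ratio_meas[OF assms] by (rule SW.integrable_const_bound)
qed

lemma EoR_alg_bounds:
  assumes "A \<in> online_algs n F"
  shows "0 \<le> EoR_alg n F D A" "EoR_alg n F D A \<le> 1"
proof -
  interpret SW: prob_space SW by (rule prob_space_SW)
  show "0 \<le> EoR_alg n F D A"
    unfolding EoR_alg_eq using AE_SW_nonneg ratio_bounds[OF assms]
    by (intro integral_nonneg_AE) (auto elim!: eventually_mono)
  show "EoR_alg n F D A \<le> 1"
    unfolding EoR_alg_eq using AE_SW_nonneg ratio_bounds[OF assms]
    by (intro SW.integral_le_const integrable_ratio assms) (auto elim!: eventually_mono)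
qed

lemma EoR_alg_eq_0:
  assumes "opt_mean = 0"
  shows "EoR_alg n F D A = 0"
proof -
  have "AE w in W. offline_opt F w = 0"
    using assms integral_nonneg_eq_0_iff_AE[OF integrable_offline_opt]
      offline_opt_nonneg[OF finite_F empty_feasible]
    by (simp add: opt_mean_def)
  \<comment> \<open>The optimum is almost surely 0, and a quotient with denominator 0 has value
    0.\<close>
  then have "AE x in SW. alg_value A (fst x) (snd x) / offline_opt F (snd x) = 0"
    using AE_SW by (auto elim!: eventually_mono dest: AE_SW)
  then show ?thesis unfolding EoR_alg_eq by (rule integral_eq_zero_AE)
qed

section \<open>The core: concentration of the truncated optimum\<close>

definition core :: "real \<Rightarrow> (nat \<Rightarrow> real) \<Rightarrow> real" where
  "core t w = offline_opt F (\<lambda>e. trunc_at t (w e))"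

lemma core_meas [measurable]: "core t \<in> borel_measurable W"
  unfolding core_def[abs_def] offline_opt_def
proof (rule borel_measurable_Max)
  show "(\<lambda>w. \<Sum>e\<in>S. trunc_at t (w e)) \<in> borel_measurable W" if "S \<in> F" for S
    using that U_less
    by (intro borel_measurable_sum measurable_compose[OF coord_meas trunc_at_measurable]) auto
qed (rule finite_F)

lemma core_nonneg: "0 \<le> core t w"
  unfolding core_def by (rule offline_opt_nonneg[OF finite_F empty_feasible])

text \<open>A crude bound that supplies the boundedness needed for integrability and for the
  Efron--Stein inequality.\<close>

lemma core_bounded:
  assumes "0 \<le> t"
  shows "core t w \<le> real (card U) * t"
proof -
  obtain S where S: "S \<in> F" "core t w = (\<Sum>e\<in>S. trunc_at t (w e))"
    unfolding core_def using offline_opt_attained[OF finite_F F_ne] by metis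
  have "(\<Sum>e\<in>S. trunc_at t (w e)) \<le> (\<Sum>e\<in>U. trunc_at t (w e))"
    using S finite_U by (intro sum_mono2) (auto simp: trunc_at_bounds)
  also have "\<dots> \<le> real (card U) * t"
    using assms by (intro sum_bounded_above) (simp add: trunc_at_bounds)
  finally show ?thesis using S by simp
qed

lemma integrable_core:
  assumes "0 \<le> t"
  shows "integrable W (core t)" "integrable W (\<lambda>w. (core t w)\<^sup>2)"
proof -
  show "integrable W (core t)"
    using assms core_nonneg core_bounded
    by (intro P.integrable_const_bound[where B = "real (card U) * t"]) auto
  show "integrable W (\<lambda>w. (core t w)\<^sup>2)"
    using assms core_nonneg core_bounded
    by (intro P.integrable_const_bound[where B = "(real (card U) * t)\<^sup>2"]) (auto intro!: power_mono)
qed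

definition core_mean :: "real \<Rightarrow> real" where
  "core_mean t = (\<integral>w. core t w \<partial>W)"

text \<open>This says that the variance is at most \<open>t * core_mean t\<close>: Efron--Stein with
  reset value 0 bounds it by \<open>t\<close> times the expected total drop, and self-bounding
  limits that total by the core itself.\<close>

lemma core_second_moment:
  assumes "0 \<le> t"
  shows "(\<integral>w. (core t w)\<^sup>2 \<partial>W) \<le> (core_mean t)\<^sup>2 + t * core_mean t"
proof -
  have upd: "core t (w(j := 0)) = offline_opt F ((\<lambda>e. trunc_at t (w e))(j := 0))" for w j
    by (simp only: core_def trunc_at_fun_upd_zero)
  have drop: "0 \<le> core t w - core t (w(j := 0)) \<and> core t w - core t (w(j := 0)) \<le> t" for w j
    unfolding upd unfolding core_def
    using assms by (intro conjI offline_opt_drop_bounds[where t = t] finite_F F_ne finite_U)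
      (simp_all add: trunc_at_bounds)
  have meas: "(\<lambda>w. w(j := 0)) \<in> W \<rightarrow>\<^sub>M W" if "j < n" for j
    using that by (intro measurable_fun_upd[where J = "{0..<n}"]) auto
  have int: "integrable W (\<lambda>w. core t w - core t (w(j := 0)))" if "j < n" for j
  proof -
      have "(\<lambda>w. core t (w(j := 0))) \<in> borel_measurable W"
      using measurable_compose[OF meas[OF that] core_meas] .
    then show ?thesis
      using drop by (intro P.integrable_const_bound[where B = t]) auto
  qed
  have "(\<integral>w. (core t w)\<^sup>2 \<partial>W)
      \<le> (core_mean t)\<^sup>2 + t * (\<Sum>j\<in>{0..<n}. \<integral>w. core t w - core t (w(j := 0)) \<partial>W)"
    unfolding core_mean_def
  proof (rule integral_power2_PiM_le)
    show "\<bar>core t w\<bar> \<le> real (card U) * t" for w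
      using core_nonneg[of t w] core_bounded[OF assms, of w] by simp
  qed (use drop in auto)
  also have "(\<Sum>j\<in>{0..<n}. \<integral>w. core t w - core t (w(j := 0)) \<partial>W)
      = (\<integral>w. (\<Sum>j\<in>{0..<n}. core t w - core t (w(j := 0))) \<partial>W)"
    using int by (subst Bochner_Integration.integral_sum) auto
  also have "\<dots> \<le> core_mean t"
    unfolding core_mean_def
  proof (rule integral_mono)
    show "(\<Sum>j\<in>{0..<n}. core t w - core t (w(j := 0))) \<le> core t w" for w
      unfolding upd unfolding core_def
      using U_subset by (intro sum_offline_opt_drop_le finite_F F_ne) (simp_all add: trunc_at_bounds)
  qed (use int integrable_core[OF assms] in auto)
  finally show ?thesis using assms by (simp add: mult_left_mono)
qed

text \<open>Chebyshev's argument with the indicator of the bad event replaced by its quadratic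
  majorant. If the core is at least half its mean \<open>?M\<close>, then so is the optimum, and the
  ratio is at most \<open>2 / ?M\<close> times the value. Otherwise the ratio is at most 1, hence at
  most \<open>4 / ?M\<^sup>2\<close> times the squared deviation. The variance bound turns the mean
  of the latter into \<open>4 * t / ?M\<close>.\<close>

lemma EoR_alg_core_le:
  assumes "A \<in> online_algs n F" "0 \<le> t"
  shows "EoR_alg n F D A * core_mean t \<le> 4 * t + 2 * alg_mean A"
proof (cases "core_mean t = 0")
  case True
  then show ?thesis using assms alg_mean_nonneg by simp
next
  case False
  let ?M = "core_mean t"
  have M: "?M > 0"
    using False core_nonneg by (simp add: core_mean_def order.strict_iff_order)
  have "integrable W (\<lambda>w. 4 / ?M\<^sup>2 * (core t w - ?M)\<^sup>2)"
    using integrable_core[OF assms(2)] by (simp add: power2_diff)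
  note int = integrable_SW[OF this]
  \<comment> \<open>Both majorants are nonnegative almost everywhere, so their sum dominates the
    ratio in either case.\<close>
  have "EoR_alg n F D A \<le>
      (\<integral>x. 4 / ?M\<^sup>2 * (core t (snd x) - ?M)\<^sup>2 + 2 / ?M * alg_value A (fst x) (snd x) \<partial>SW)"
    unfolding EoR_alg_eq
  proof (rule integral_mono_AE)
    show "AE x in SW. alg_value A (fst x) (snd x) / offline_opt F (snd x)
        \<le> 4 / ?M\<^sup>2 * (core t (snd x) - ?M)\<^sup>2 + 2 / ?M * alg_value A (fst x) (snd x)"
      using AE_SW_nonneg
    proof eventually_elim
      case (elim x)
      let ?a = "alg_value A (fst x) (snd x)" and ?f = "offline_opt F (snd x)"
      have a: "0 \<le> ?a" using assms(1) elim by (rule alg_value_nonneg)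
      have cf: "core t (snd x) \<le> ?f"
        unfolding core_def using elim U_less
        by (intro offline_opt_mono finite_F F_ne) (auto simp: trunc_at_bounds)
      show ?case
      proof (cases "?M / 2 \<le> core t (snd x)")
        case True
        then have "?M / 2 \<le> ?f" using cf by simp
        then have "?a / ?f \<le> ?a / (?M / 2)" using a M by (intro divide_left_mono) auto
        also have "\<dots> = 2 / ?M * ?a" by simp
        finally have "?a / ?f \<le> 2 / ?M * ?a" .
        moreover have "0 \<le> 4 / ?M\<^sup>2 * (core t (snd x) - ?M)\<^sup>2" by simp
        ultimately show ?thesis by linarith
      next
        case False
        then have "(?M / 2)\<^sup>2 \<le> (?M - core t (snd x))\<^sup>2" using M by (intro power_mono) auto
        then have "1 \<le> 4 / ?M\<^sup>2 * (core t (snd x) - ?M)\<^sup>2"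
          using M by (simp add: field_simps power2_commute)
        moreover have "0 \<le> 2 / ?M * ?a" using a M by simp
        ultimately show ?thesis
          using ratio_bounds(2)[OF assms(1) elim, of "fst x"] by linarith
      qed
    qed
  qed (intro integrable_ratio Bochner_Integration.integrable_add int
      integrable_mult_right integrable_alg_value assms)+
  also have "\<dots> = 4 / ?M\<^sup>2 * (\<integral>w. (core t w - ?M)\<^sup>2 \<partial>W) + 2 / ?M * alg_mean A"
    using int integrable_alg_value[OF assms(1)]
    by (simp add: alg_mean_def integral_SW[of "\<lambda>w. (core t w - ?M)\<^sup>2"])
  also have "(\<integral>w. (core t w - ?M)\<^sup>2 \<partial>W) = (\<integral>w. (core t w)\<^sup>2 \<partial>W) - ?M\<^sup>2"
    using integrable_core[OF assms(2)]
    by (simp add: power2_diff core_mean_def[symmetric] P.prob_space) (simp add: power2_eq_square)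
  also have "4 / ?M\<^sup>2 * ((\<integral>w. (core t w)\<^sup>2 \<partial>W) - ?M\<^sup>2) \<le> 4 / ?M\<^sup>2 * (t * ?M)"
    using core_second_moment[OF assms(2)] by (intro mult_left_mono) auto
  finally have "EoR_alg n F D A \<le> 4 * t / ?M + 2 * alg_mean A / ?M"
    using M by (simp add: power2_eq_square)
  then show ?thesis using M by (simp add: field_simps)
qed

section \<open>The tail and the earnings of the threshold algorithm\<close>

definition tail_mean :: "real \<Rightarrow> real" where
  "tail_mean t = (\<Sum>i\<in>U. \<integral>x. indicator {t<..} x * x \<partial>D i)"

lemma integrable_tail:
  assumes "i < n"
  shows "integrable (D i) (\<lambda>x. indicator {t<..} x * x)"
  using integrable_mult_indicator[of "{t<..}" "D i" "\<lambda>x. x"] D_integrable[OF assms] by simp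

lemma opt_mean_le:
  assumes "0 \<le> t"
  shows "opt_mean \<le> core_mean t + tail_mean t"
proof -
  have int: "integrable W (\<lambda>w. indicator {t<..} (w i) * w i)" if "i \<in> U" for i
    using integrable_component[OF _ integrable_tail] U_less that by blast
  have "opt_mean \<le> (\<integral>w. core t w + (\<Sum>i\<in>U. indicator {t<..} (w i) * w i) \<partial>W)"
    unfolding opt_mean_def
  proof (rule integral_mono_AE)
    show "AE w in W. offline_opt F w \<le> core t w + (\<Sum>i\<in>U. indicator {t<..} (w i) * w i)"
      using AE_nonneg unfolding core_def
      by eventually_elim
        (rule offline_opt_le_add_sum[OF finite_F F_ne finite_U],
          use U_less in \<open>auto simp: trunc_at_def indicator_def\<close>)
  qed (intro Bochner_Integration.integrable_add Bochner_Integration.integrable_sum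
      int integrable_core[OF assms] integrable_offline_opt)+
  also have "\<dots> = core_mean t + (\<Sum>i\<in>U. \<integral>w. indicator {t<..} (w i) * w i \<partial>W)"
    unfolding core_mean_def
    by (subst Bochner_Integration.integral_add[OF integrable_core(1)[OF assms]
          Bochner_Integration.integrable_sum[OF int]], assumption)
      (simp only: Bochner_Integration.integral_sum[OF int])
  also have "(\<Sum>i\<in>U. \<integral>w. indicator {t<..} (w i) * w i \<partial>W) = tail_mean t"
    unfolding tail_mean_def
    by (intro sum.cong refl integral_component[where h = "\<lambda>x. indicator {t<..} x * x"] U_less) auto
  finally show ?thesis .
qed

lemma prod_over_U:
  fixes h :: "nat \<Rightarrow> real \<Rightarrow> real"
  assumes "\<And>i. i \<in> U \<Longrightarrow> integrable (D i) (h i)"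
  shows "(\<integral>w. (\<Prod>i\<in>U. h i (w i)) \<partial>W) = (\<Prod>i\<in>U. integral\<^sup>L (D i) (h i))"
    and "integrable W (\<lambda>w. \<Prod>i\<in>U. h i (w i))"
proof -
  \<comment> \<open>Coordinates outside \<open>U\<close> receive the constant factor 1, of integral
    1, so that the product formula over all of \<open>{0..<n}\<close> applies.\<close>
  let ?h = "\<lambda>i x. if i \<in> U then h i x else 1"
  have int: "integrable (D i) (?h i)" for i using assms by (cases "i \<in> U") auto
  have *: "(\<Prod>i\<in>{0..<n}. ?h i (w i)) = (\<Prod>i\<in>U. h i (w i))" for w
    by (intro prod.mono_neutral_cong_right U_subset) auto
  have "(\<integral>w. (\<Prod>i\<in>{0..<n}. ?h i (w i)) \<partial>W) = (\<Prod>i\<in>{0..<n}. integral\<^sup>L (D i) (?h i))"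
    using int by (intro product_integral_prod) auto
  also have "\<dots> = (\<Prod>i\<in>{0..<n}. if i \<in> U then integral\<^sup>L (D i) (h i) else 1)"
    using M.prob_space by (intro prod.cong) auto
  also have "\<dots> = (\<Prod>i\<in>U. integral\<^sup>L (D i) (h i))"
    by (intro prod.mono_neutral_cong_right U_subset) auto
  finally show "(\<integral>w. (\<Prod>i\<in>U. h i (w i)) \<partial>W) = (\<Prod>i\<in>U. integral\<^sup>L (D i) (h i))"
    unfolding * .
  have "integrable W (\<lambda>w. \<Prod>i\<in>{0..<n}. ?h i (w i))"
    using int by (intro product_integrable_prod) auto
  then show "integrable W (\<lambda>w. \<Prod>i\<in>U. h i (w i))" unfolding * .
qed

text \<open>With probability 1/2 some usable weight exceeds \<open>t\<close>, and then more than
  \<open>t\<close> is earned. For the tail, whether all elements other than \<open>i\<close> stay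
  below the threshold is independent of the weight of \<open>i\<close> and has probability at least
  1/2, so at least half of each tail contribution is collected.\<close>

lemma threshold_alg_mean:
  assumes "0 \<le> t" "(\<Prod>i\<in>U. measure (D i) {..t}) = 1/2"
  shows "t \<le> 2 * alg_mean (threshold_alg F t)" (is "_ \<le> 2 * alg_mean ?T")
    and "tail_mean t \<le> 2 * alg_mean (threshold_alg F t)"
proof -
  have ind_int: "integrable (D i) (indicator {..t} :: real \<Rightarrow> real)" for i
    by (intro M.integrable_const_bound[where B = 1] borel_measurable_D) (auto simp: indicator_def)
  have ind: "integral\<^sup>L (D i) (indicator {..t} :: real \<Rightarrow> real) = measure (D i) {..t}" for i
    by simp
  have q_int: "integrable W (\<lambda>w. \<Prod>j\<in>U. indicator {..t} (w j) :: real)"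
    using prod_over_U(2)[of "\<lambda>_. indicator {..t}"] ind_int by blast
  have q: "(\<integral>w. (\<Prod>j\<in>U. indicator {..t} (w j)) \<partial>W) = (1/2 :: real)"
    using prod_over_U(1)[of "\<lambda>_. indicator {..t}"] ind_int assms(2) ind by simp
  have "t / 2 = (\<integral>w. t * (1 - (\<Prod>j\<in>U. indicator {..t} (w j))) \<partial>W)"
    using q q_int by (simp add: P.prob_space)
  also have "\<dots> = (\<integral>x. t * (1 - (\<Prod>j\<in>U. indicator {..t} (snd x j))) \<partial>SW)"
    using q_int by (intro integral_SW[symmetric]) auto
  also have "\<dots> \<le> alg_mean ?T"
    unfolding alg_mean_def
  proof (rule integral_mono_AE)
    show "integrable SW (\<lambda>x. t * (1 - (\<Prod>j\<in>U. indicator {..t} (snd x j))))"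
      using q_int by (intro integrable_SW) auto
    show "AE x in SW. t * (1 - (\<Prod>j\<in>U. indicator {..t} (snd x j))) \<le> alg_value ?T (fst x) (snd x)"
      using AE_SW_nonneg
      by eventually_elim (use assms(1) finite_U U_less in \<open>intro alg_value_threshold_ge; auto\<close>)
  qed (rule integrable_alg_value[OF threshold_alg_in])
  finally show "t \<le> 2 * alg_mean ?T" by simp
  \<comment> \<open>Placing the tail factor of \<open>i\<close> in coordinate \<open>i\<close> turns
    \<open>?p i\<close> into one product over \<open>U\<close>, whose mean factors.\<close>
  let ?h = "\<lambda>i j x. if j = i then indicator {t<..} x * x else indicator {..t} x :: real"
  let ?p = "\<lambda>i w. indicator {t<..} (w i) * w i * (\<Prod>j\<in>U - {i}. indicator {..t} (w j)) :: real"
  have p_eq: "?p i w = (\<Prod>j\<in>U. ?h i j (w j))" if "i \<in> U" for i w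
    using that finite_U by (simp add: prod.remove[of U i])
  have h_int: "integrable (D j) (?h i j)" if "j \<in> U" for i j
    using integrable_tail[OF U_less[OF that]] ind_int by (cases "j = i") simp_all
  have p_int: "integrable W (?p i)" if "i \<in> U" for i
    using prod_over_U(2)[of "?h i"] h_int p_eq[OF that] by simp
  have p_ge: "(\<integral>x. indicator {t<..} x * x \<partial>D i) / 2 \<le> (\<integral>w. ?p i w \<partial>W)" if i: "i \<in> U" for i
  proof -
    have "(\<integral>w. ?p i w \<partial>W) = (\<Prod>j\<in>U. integral\<^sup>L (D j) (?h i j))"
      using prod_over_U(1)[of "?h i"] h_int p_eq[OF that] by simp
    also have "\<dots> = (\<integral>x. indicator {t<..} x * x \<partial>D i) * (\<Prod>j\<in>U - {i}. measure (D j) {..t})"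
      using i finite_U ind by (simp add: prod.remove[of U i])
    finally have eq: "(\<integral>w. ?p i w \<partial>W) =
      (\<integral>x. indicator {t<..} x * x \<partial>D i) * (\<Prod>j\<in>U - {i}. measure (D j) {..t})" .
    \<comment> \<open>Omitting the factor of \<open>i\<close>, which is at most 1, can only increase
      the product.\<close>
    have "1/2 = measure (D i) {..t} * (\<Prod>j\<in>U - {i}. measure (D j) {..t})"
      using assms(2) i finite_U by (simp add: prod.remove[of U i])
    also have "\<dots> \<le> 1 * (\<Prod>j\<in>U - {i}. measure (D j) {..t})"
      by (intro mult_right_mono prod_nonneg M.prob_le_1) auto
    finally have "1/2 \<le> (\<Prod>j\<in>U - {i}. measure (D j) {..t})" by simp
    moreover have "0 \<le> (\<integral>x. indicator {t<..} x * x \<partial>D i)"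
      using assms(1) by (intro Bochner_Integration.integral_nonneg) (auto simp: indicator_def)
    ultimately show ?thesis unfolding eq using mult_left_mono by fastforce
  qed
  have "tail_mean t / 2 = (\<Sum>i\<in>U. (\<integral>x. indicator {t<..} x * x \<partial>D i) / 2)"
    by (simp add: tail_mean_def sum_divide_distrib)
  also have "\<dots> \<le> (\<Sum>i\<in>U. \<integral>w. ?p i w \<partial>W)"
    using p_ge by (intro sum_mono)
  also have "\<dots> = (\<integral>w. (\<Sum>i\<in>U. ?p i w) \<partial>W)"
    using p_int by (intro Bochner_Integration.integral_sum[symmetric])
  also have "\<dots> = (\<integral>x. (\<Sum>i\<in>U. ?p i (snd x)) \<partial>SW)"
    using p_int by (intro integral_SW[symmetric] borel_measurable_sum borel_measurable_integrable)
  also have "\<dots> \<le> alg_mean ?T"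
    unfolding alg_mean_def
  proof (rule integral_mono_AE)
    show "integrable SW (\<lambda>x. \<Sum>i\<in>U. ?p i (snd x))"
      using p_int by (intro integrable_SW[where h = "\<lambda>w. \<Sum>i\<in>U. ?p i w"] Bochner_Integration.integrable_sum)
    show "AE x in SW. (\<Sum>i\<in>U. ?p i (snd x)) \<le> alg_value ?T (fst x) (snd x)"
      using AE_SW_nonneg
      by eventually_elim (use assms(1) finite_U U_less in \<open>intro alg_value_threshold_ge; auto\<close>)
  qed (rule integrable_alg_value[OF threshold_alg_in])
  finally show "tail_mean t \<le> 2 * alg_mean ?T" by simp
qed

text \<open>With \<open>V\<close> the supremum ratio times the mean optimum, both \<open>A\<close>
  and the threshold algorithm have mean at most \<open>V\<close>, and \<open>t \<le> 2 * V\<close>.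
  The core contributes \<open>4 * t + 2 * V \<le> 10 * V\<close>. The tail contributes
  \<open>2 * V\<close>, since the expected ratio is at most 1. Together this gives 12.\<close>

lemma EoR_alg_le:
  assumes A: "A \<in> online_algs n F"
  shows "EoR_alg n F D A \<le> 12 * RoE n F D"
proof (cases "opt_mean = 0")
  case True
  then show ?thesis using EoR_alg_eq_0 RoE_nonneg by simp
next
  case False
  then have pos: "0 < opt_mean" using opt_mean_nonneg by simp
  \<comment> \<open>A median exists only for a nonempty set of usable elements; without any, the
    optimum would be identically 0.\<close>
  have "U \<noteq> {}"
  proof
    assume "U = {}"
    then have "F = {{}}" using F_ne by auto
    then have "offline_opt F w = 0" for w by (simp add: offline_opt_def)
    then show False using False by (simp add: opt_mean_def)
  qed
  then obtain t where t: "0 \<le> t" "(\<Prod>i\<in>U. measure (D i) {..t}) = 1/2"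
    using prod_cdf_median[of U D] finite_U real_distribution_D D_no_atoms D_nonneg U_less by metis
  define e where "e = EoR_alg n F D A"
  define V where "V = RoE n F D * opt_mean"
  have e: "0 \<le> e" "e \<le> 1" using EoR_alg_bounds[OF A] by (simp_all add: e_def)
  have T: "alg_mean (threshold_alg F t) \<le> V"
    unfolding V_def by (rule alg_mean_le_RoE[OF threshold_alg_in])
  have "e * core_mean t \<le> 4 * t + 2 * alg_mean A"
    unfolding e_def using A t(1) by (rule EoR_alg_core_le)
  moreover have "alg_mean A \<le> V" unfolding V_def by (rule alg_mean_le_RoE[OF A])
  ultimately have core: "e * core_mean t \<le> 10 * V"
    using threshold_alg_mean(1)[OF t] T by linarith
  have "tail_mean t \<le> 2 * V" using threshold_alg_mean(2)[OF t] T by linarith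
  moreover have "0 \<le> V" using RoE_nonneg opt_mean_nonneg by (simp add: V_def)
  ultimately have tail: "e * tail_mean t \<le> 2 * V"
    using e mult_left_mono[of "tail_mean t" "2 * V" e] mult_right_mono[of e 1 "2 * V"] by simp
  have "e * opt_mean \<le> e * (core_mean t + tail_mean t)"
    using opt_mean_le[OF t(1)] e by (intro mult_left_mono)
  then have "e * opt_mean \<le> (12 * RoE n F D) * opt_mean"
    using core tail by (simp add: V_def algebra_simps)
  then show ?thesis using pos by (simp add: e_def)
qed

lemma EoR_le: "EoR n F D \<le> 12 * RoE n F D"
  unfolding EoR_def using threshold_alg_in EoR_alg_le by (intro cSUP_least) auto

end

theorem theorem3:
  fixes n :: nat and F :: "nat set set" and D :: "nat \<Rightarrow> real measure"
  assumes "F \<subseteq> Pow {0..<n}"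
    and "downward_closed F"
    and "{} \<in> F"
    and "\<forall>i<n. prob_space (D i)"
    and "\<forall>i<n. sets (D i) = sets borel"
    and "\<forall>i<n. AE x in D i. 0 \<le> x"
    and "\<forall>i<n. \<forall>x. emeasure (D i) {x} = 0"
    and "\<forall>i<n. integrable (D i) (\<lambda>x. x)"
  shows "RoE n F D \<ge> EoR n F D / 68"
proof -
  \<comment> \<open>The locale wants a Borel probability measure at every index, so indices from
    \<open>n\<close> on receive a point mass at 0; atoms are excluded only below \<open>n\<close>.
    The product over \<open>{0..<n}\<close>, and with it both ratios, is unchanged.\<close>
  define D' where "D' i = (if i < n then D i else return borel 0)" for i
  have prob: "prob_space (D' i)" for i
    using assms(4) by (auto simp: D'_def intro: prob_space_return)
  have eq: "D' i = D i" if "i < n" for i using that by (simp add: D'_def)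
  have "prophet_axioms D' n F"
  proof
    show "sets (D' i) = sets borel" for i using assms(5) by (simp add: D'_def)
    show "AE x in D' i. 0 \<le> x" if "i < n" for i
      unfolding eq[OF that] using assms(6) that by blast
  qed (use assms in \<open>simp_all add: eq measure_def\<close>)
  with product_prob_spaceI[OF prob] interpret prophet D' n F
    by (rule prophet.intro)
  have "PiM {0..<n} D' = PiM {0..<n} D"
    by (intro PiM_cong) (auto simp: D'_def)
  then have "EoR n F D = EoR n F D'" "RoE n F D = RoE n F D'"
    by (simp_all add: EoR_def RoE_def EoR_alg_def RoE_alg_def)
  \<comment> \<open>Nonnegativity of \<open>RoE\<close> allows the factor 12 to be weakened to
    68.\<close>
  then show ?thesis using EoR_le RoE_nonneg by simp
qed

end
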